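(* The field extension $\mathbb{R}(P,Q)\subset\mathbb{R}(x,y)$ is of degree $6$.
   Context: The polynomials $P,Q\in\mathbb{R}[x,y]$ are the components of the following specific Pinchuk map: put $t=xy-1$, $h=t(xt+1)$, $f=(xt+1)^2(t^2+y)$, $P=f+h$, and $Q=-t^2-6th(h+1)-u(f,h)$, where $u(f,h)=170fh+91h^2+195fh^2+69h^3+75fh^3+\tfrac{75}{4}h^4$. *)

theory Defs
  imports
    "HOL-Algebra.Algebraic_Closure_Type"
    "HOL-Algebra.Generated_Fields"
    "HOL-Algebra.Embedded_Algebras"
    "HOL-Computational_Algebra.Computational_Algebra"
begin

(* R[x,y] is represented as R[x][y]: the inner variable is x, the outer one is y. *)

type_synonym real_poly2 = "real poly poly"

definition const2 :: "real \<Rightarrow> real_poly2" where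
  "const2 c = [:[:c:]:]"

definition var_x :: real_poly2 where
  "var_x = [:[:0, 1:]:]"

definition var_y :: real_poly2 where
  "var_y = [:0, 1:]"

definition pinchuk_t :: real_poly2 where
  "pinchuk_t = var_x * var_y - 1"

definition pinchuk_h :: real_poly2 where
  "pinchuk_h = pinchuk_t * (var_x * pinchuk_t + 1)"

definition pinchuk_f :: real_poly2 where
  "pinchuk_f = (var_x * pinchuk_t + 1)^2 * (pinchuk_t^2 + var_y)"

definition pinchuk_u :: "real_poly2 \<Rightarrow> real_poly2 \<Rightarrow> real_poly2" where
  "pinchuk_u f h =
     170 * f * h + 91 * h^2 + 195 * f * h^2 + 69 * h^3 + 75 * f * h^3 + const2 (75/4) * h^4"

definition pinchuk_P :: real_poly2 where
  "pinchuk_P = pinchuk_f + pinchuk_h"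

definition pinchuk_Q :: real_poly2 where
  "pinchuk_Q = - (pinchuk_t^2) - 6 * pinchuk_t * pinchuk_h * (pinchuk_h + 1)
     - pinchuk_u pinchuk_f pinchuk_h"

definition ratfun_field :: "real_poly2 fract ring" where
  "ratfun_field = ring_of_type_algebra"

definition ratfun_subfield :: "real_poly2 \<Rightarrow> real_poly2 \<Rightarrow> real_poly2 fract set" where
  "ratfun_subfield p q =
     generate_field ratfun_field
       (range (\<lambda>c. to_fract (const2 c)) \<union> {to_fract p, to_fract q})"

lemma carrier_ratfun_field [simp]: "carrier ratfun_field = UNIV"
  by (simp add: ratfun_field_def ring_of_type_algebra_def)

lemma field_ratfun_field: "field ratfun_field"
  unfolding ratfun_field_def by (rule field_from_type_algebra)

lemma subfield_ratfun_subfield: "subfield (ratfun_subfield p q) ratfun_field"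
  unfolding ratfun_subfield_def
  by (rule field.generate_field_is_subfield[OF field_ratfun_field]) simp

end

theory Submission
  imports Defs
begin

text \<open>
  Write \<open>P\<close>, \<open>Q\<close>, \<open>f\<close>, \<open>h\<close>, \<open>t\<close> for the given polynomials.  The whole proof rests on the relation
  \<open>t f = h f - h\<^sup>2 (h + 1)\<close> (lemma \<open>pinchuk_t_f\<close>).  It expresses \<open>t\<close> through \<open>f = P - h\<close> and \<open>h\<close>, and
  \<open>h = t (x t + 1)\<close> and \<open>t = x y - 1\<close> then give \<open>x\<close> and \<open>y\<close>.  Hence \<open>\<real>(x,y) = \<real>(P,h)\<close>
  (lemma \<open>pinchuk_P_h_generate\<close>), and \<open>P\<close>, \<open>h\<close> are algebraically independent.

  Replacing \<open>f\<close> by \<open>P - h\<close> in \<open>f\<^sup>2 Q\<close>, and every product \<open>t f\<close> by the right-hand side of the relation,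
  gives \<open>(h - P)\<^sup>2 Q = N(P, h)\<close> with a polynomial \<open>N\<close> of degree 6 in \<open>h\<close>.  So over \<open>\<real>(P)\<close> the element
  \<open>Q\<close> is the rational function \<open>N / D\<close> of \<open>h\<close>, where \<open>D = (h - P)\<^sup>2\<close>, and it is in lowest terms because
  \<open>N(P, P) = - P\<^sup>4 (P + 1)\<^sup>2\<close> is not zero.  The degree of \<open>\<real>(P)(h)\<close> over \<open>\<real>(P)(N / D)\<close> is the larger one of
  the degrees of \<open>N\<close> and \<open>D\<close>, that is 6.

  The upper bound comes from the equation \<open>N(P, h) - Q (h - P)\<^sup>2 = 0\<close> of degree 6 for \<open>h\<close>
  (lemma \<open>pinchuk_h_sextic\<close>).  For the lower bound, a relation of degree less than 6 for \<open>h\<close> over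
  \<open>\<real>(P,Q)\<close>, cleared of denominators, becomes \<open>\<Sum>\<^sub>j g\<^sub>j N\<^sup>j D\<^sup>m\<^sup>-\<^sup>j = 0\<close> in \<open>\<real>[P][h]\<close>, where every
  \<open>g\<^sub>j\<close> has degree less than 6 in \<open>h\<close>.  Then \<open>N\<close> divides \<open>g\<^sub>0 D\<^sup>m\<close>, hence \<open>g\<^sub>0\<close>, so \<open>g\<^sub>0 = 0\<close>; a factor
  \<open>N\<close> cancels, and all \<open>g\<^sub>j\<close> vanish one after the other
  (lemma \<open>homogenized_sum_eq_0_imp_coeffs_eq_0\<close>).

  Algebraic independence of \<open>P\<close> and \<open>h\<close> enters through real points: the relations above invert the map
  \<open>(x, y) \<mapsto> (P, h)\<close> off a thin set, so its image is large enough to force a polynomial that vanishes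
  on it to be zero (lemmas \<open>pinchuk_P_h_dominant\<close> and \<open>eval2_generically_0_imp_0\<close>).  This allows
  substitutions into polynomials to be handled by their values alone.
\<close>

section \<open>Polynomials in two variables and their values\<close>

definition eval2 :: "real_poly2 \<Rightarrow> real \<Rightarrow> real \<Rightarrow> real" where
  "eval2 G x y = poly (poly G [:y:]) x"

lemma eval2_ring_simps [simp]:
  "eval2 0 x y = 0" "eval2 1 x y = 1"
  "eval2 (G + H) x y = eval2 G x y + eval2 H x y"
  "eval2 (G - H) x y = eval2 G x y - eval2 H x y"
  "eval2 (- G) x y = - eval2 G x y"
  "eval2 (G * H) x y = eval2 G x y * eval2 H x y"
  "eval2 (G ^ n) x y = eval2 G x y ^ n"
  "eval2 (numeral k) x y = numeral k"
  "eval2 (const2 c) x y = c" "eval2 var_x x y = x" "eval2 var_y x y = y"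
  by (simp_all add: eval2_def const2_def var_x_def var_y_def)

lemma eval2_sum [simp]: "eval2 (\<Sum>i\<in>I. G i) x y = (\<Sum>i\<in>I. eval2 (G i) x y)"
  by (simp add: eval2_def poly_sum)

lemma eval2_eq_sum_coeff:
  assumes "Polynomial.degree G \<le> n"
  shows "eval2 G x y = (\<Sum>j\<le>n. poly (Polynomial.coeff G j) x * y ^ j)"
proof -
  have "poly G [:y:] = (\<Sum>j\<le>n. Polynomial.coeff G j * [:y:] ^ j)"
    unfolding poly_altdef using assms
    by (intro sum.mono_neutral_left) (auto simp: coeff_eq_0)
  then show ?thesis
    by (simp add: eval2_def poly_sum)
qed

lemma poly_eq_0_if_vanishes_cofinitely:
  fixes a :: "'a::{idom, ring_char_0} poly"
  assumes "finite B" "\<And>x. x \<notin> B \<Longrightarrow> poly a x = 0"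
  shows "a = 0"
proof (rule ccontr)
  assume "a \<noteq> 0"
  then have "finite (B \<union> {x. poly a x = 0})"
    using assms(1) poly_roots_finite by blast
  moreover have "B \<union> {x. poly a x = 0} = UNIV"
    using assms(2) by blast
  ultimately show False
    using infinite_UNIV_char_0 by metis
qed

text \<open>
  The exceptional set may be any union of finitely many lines \<open>y = c\<close> with finitely many further points
  on each of the other horizontal lines: on such a line \<open>G\<close> is a polynomial in \<open>x\<close> with infinitely many
  roots, and \<open>G\<close> as a polynomial in \<open>y\<close> then has infinitely many constants as roots.
\<close>

lemma eval2_generically_0_imp_0:
  assumes "finite B" "\<And>y. y \<notin> B \<Longrightarrow> finite (C y)"
    and "\<And>x y. y \<notin> B \<Longrightarrow> x \<notin> C y \<Longrightarrow> eval2 G x y = 0"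
  shows "G = 0"
proof -
  have *: "poly G [:y:] = 0" if "y \<notin> B" for y
    using assms that by (intro poly_eq_0_if_vanishes_cofinitely[of "C y"]) (auto simp: eval2_def)
  show ?thesis
  proof (rule ccontr)
    assume "G \<noteq> 0"
    then have "finite {a. poly G a = 0}"
      by (rule poly_roots_finite)
    moreover have "(\<lambda>y. [:y:]) ` (- B) \<subseteq> {a. poly G a = 0}"
      using * by auto
    ultimately have "finite ((\<lambda>y::real. [:y:]) ` (- B))"
      by (rule rev_finite_subset)
    then have "finite (- B)"
      by (rule finite_imageD) (auto simp: inj_on_def)
    with assms(1) have "finite (UNIV :: real set)"
      by (metis finite_compl)
    then show False
      using infinite_UNIV_char_0 by blast
  qed
qed

text \<open>
  This is the ring \<open>\<real>[p, q]\<close>.  Membership is expressed by values at real points, which determine a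
  polynomial, so that no substitution homomorphism from \<open>\<real>[u, v]\<close> has to be set up.
\<close>

definition value_subring :: "real_poly2 \<Rightarrow> real_poly2 \<Rightarrow> real_poly2 set" where
  "value_subring p q =
     {a. \<exists>G. \<forall>x y. eval2 a x y = eval2 G (eval2 p x y) (eval2 q x y)}"

lemma value_subringI:
  "(\<And>x y. eval2 a x y = eval2 G (eval2 p x y) (eval2 q x y)) \<Longrightarrow> a \<in> value_subring p q"
  unfolding value_subring_def by blast

lemma value_subring_closed:
  shows "const2 c \<in> value_subring p q" "p \<in> value_subring p q" "q \<in> value_subring p q"
    and "1 \<in> value_subring p q"
    and "a \<in> value_subring p q \<Longrightarrow> - a \<in> value_subring p q"
    and "\<lbrakk> a \<in> value_subring p q; b \<in> value_subring p q \<rbrakk> \<Longrightarrow> a + b \<in> value_subring p q"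
    and "\<lbrakk> a \<in> value_subring p q; b \<in> value_subring p q \<rbrakk> \<Longrightarrow> a * b \<in> value_subring p q"
proof -
  show "const2 c \<in> value_subring p q"
    by (rule value_subringI[where G = "const2 c"]) simp
  show "p \<in> value_subring p q"
    by (rule value_subringI[where G = var_x]) simp
  show "q \<in> value_subring p q"
    by (rule value_subringI[where G = var_y]) simp
  show "1 \<in> value_subring p q"
    by (rule value_subringI[where G = 1]) simp
next
  assume "a \<in> value_subring p q"
  then obtain G where G: "\<And>x y. eval2 a x y = eval2 G (eval2 p x y) (eval2 q x y)"
    unfolding value_subring_def by blast
  then show "- a \<in> value_subring p q"
    by (intro value_subringI[where G = "- G"]) simp
  assume "b \<in> value_subring p q"
  then obtain H where H: "\<And>x y. eval2 b x y = eval2 H (eval2 p x y) (eval2 q x y)"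
    unfolding value_subring_def by blast
  show "a + b \<in> value_subring p q"
    by (rule value_subringI[where G = "G + H"]) (simp add: G H)
  show "a * b \<in> value_subring p q"
    by (rule value_subringI[where G = "G * H"]) (simp add: G H)
qed

section \<open>The field of rational functions and its subfields\<close>

lemma ratfun_field_ops [simp]:
  "\<one>\<^bsub>ratfun_field\<^esub> = 1" "\<zero>\<^bsub>ratfun_field\<^esub> = 0"
  "a \<oplus>\<^bsub>ratfun_field\<^esub> b = a + b" "a \<otimes>\<^bsub>ratfun_field\<^esub> b = a * b"
  by (simp_all add: ratfun_field_def ring_of_type_algebra_def)

lemma domain_ratfun_field: "domain ratfun_field"
  using field_ratfun_field by (rule field.axioms)

lemma ring_ratfun_field: "ring ratfun_field"
  using domain_ratfun_field by (simp add: domain_def cring_def)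

lemma ratfun_field_uminus [simp]: "\<ominus>\<^bsub>ratfun_field\<^esub> a = - a"
  using abelian_group.minus_equality[of ratfun_field "- a" a] field_ratfun_field
  by (simp add: field_def domain_def cring_def ring_def)

lemma ratfun_field_inverse [simp]: "a \<noteq> 0 \<Longrightarrow> inv\<^bsub>ratfun_field\<^esub> a = inverse a"
  using monoid.inv_char[of ratfun_field a "inverse a"] field_ratfun_field
  by (simp add: field_def domain_def cring_def ring_def)

lemma ratfun_field_pow [simp]: "a [^]\<^bsub>ratfun_field\<^esub> (n::nat) = a ^ n"
  by (induction n) (simp_all add: mult.commute)

lemma subfield_ratfun_closed:
  assumes "subfield E ratfun_field"
  shows "0 \<in> E" "1 \<in> E" "a \<in> E \<Longrightarrow> - a \<in> E"
    and "\<lbrakk> a \<in> E; b \<in> E \<rbrakk> \<Longrightarrow> a + b \<in> E" "\<lbrakk> a \<in> E; b \<in> E \<rbrakk> \<Longrightarrow> a - b \<in> E"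
    and "\<lbrakk> a \<in> E; b \<in> E \<rbrakk> \<Longrightarrow> a * b \<in> E" "\<lbrakk> a \<in> E; b \<in> E \<rbrakk> \<Longrightarrow> a / b \<in> E"
    and "a \<in> E \<Longrightarrow> a ^ n \<in> E" "numeral k \<in> E"
proof -
  note sub = subringE[OF subfieldE(1)[OF assms], simplified]
  show zero: "0 \<in> E" and one: "1 \<in> E" and minus: "a \<in> E \<Longrightarrow> - a \<in> E" for a
    using sub by simp_all
  show add: "\<lbrakk> a \<in> E; b \<in> E \<rbrakk> \<Longrightarrow> a + b \<in> E"
    and mult: "\<lbrakk> a \<in> E; b \<in> E \<rbrakk> \<Longrightarrow> a * b \<in> E" for a b
    using sub by simp_all
  show "\<lbrakk> a \<in> E; b \<in> E \<rbrakk> \<Longrightarrow> a - b \<in> E"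
    using add[of a "- b"] minus by simp
  have "inverse b \<in> E" if "b \<in> E"
    using ring.subfield_m_inv(1)[OF ring_ratfun_field assms, of b] that by (cases "b = 0") simp_all
  then show "\<lbrakk> a \<in> E; b \<in> E \<rbrakk> \<Longrightarrow> a / b \<in> E"
    using mult by (simp add: divide_inverse)
  show "a \<in> E \<Longrightarrow> a ^ n \<in> E"
    by (induction n) (simp_all add: one mult)
  have "of_nat m \<in> E" for m
    by (induction m) (simp_all add: zero one add)
  from this[of "numeral k"] show "numeral k \<in> E"
    by simp
qed

lemma ratfun_subfield_generators:
  "to_fract (const2 c) \<in> ratfun_subfield p q"
  "to_fract p \<in> ratfun_subfield p q" "to_fract q \<in> ratfun_subfield p q"
  by (auto simp: ratfun_subfield_def intro!: generate_field.incl)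

lemma ratfun_subfield_fraction:
  assumes "k \<in> ratfun_subfield p q"
  obtains a b where "a \<in> value_subring p q" "b \<in> value_subring p q" "b \<noteq> 0"
    "k = to_fract a / to_fract b"
proof -
  let ?S = "value_subring p q"
  have "\<exists>a\<in>?S. \<exists>b\<in>?S. b \<noteq> 0 \<and> k = to_fract a / to_fract b"
    using assms unfolding ratfun_subfield_def
  proof (induction rule: generate_field.induct)
    case one
    show ?case
      by (intro bexI[of _ 1]) (simp_all add: value_subring_closed)
  next
    case (incl h)
    then obtain a where "h = to_fract a" "a \<in> ?S"
      using value_subring_closed(1-3) by blast
    then show ?case
      by (intro bexI[of _ a] bexI[of _ 1]) (simp_all add: value_subring_closed)
  next
    case (a_inv h)
    then obtain a b where "a \<in> ?S" "b \<in> ?S" "b \<noteq> 0" "h = to_fract a / to_fract b"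
      by blast
    then show ?case
      by (intro bexI[of _ "- a"] bexI[of _ b]) (simp_all add: value_subring_closed)
  next
    case (m_inv h)
    then obtain a b where "a \<in> ?S" "b \<in> ?S" "b \<noteq> 0" "h = to_fract a / to_fract b"
      by blast
    moreover from this m_inv have "a \<noteq> 0"
      by auto
    ultimately show ?case
      using m_inv by (intro bexI[of _ b] bexI[of _ a]) simp_all
  next
    case (eng_add h1 h2)
    from eng_add.IH(1) obtain a b
      where "a \<in> ?S" "b \<in> ?S" "b \<noteq> 0" "h1 = to_fract a / to_fract b"
      by blast
    moreover from eng_add.IH(2) obtain c d
      where "c \<in> ?S" "d \<in> ?S" "d \<noteq> 0" "h2 = to_fract c / to_fract d"
      by blast
    ultimately show ?case
      by (intro bexI[of _ "a * d + c * b"] bexI[of _ "b * d"])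
        (simp_all add: value_subring_closed add_frac_eq)
  next
    case (eng_mult h1 h2)
    from eng_mult.IH(1) obtain a b
      where "a \<in> ?S" "b \<in> ?S" "b \<noteq> 0" "h1 = to_fract a / to_fract b"
      by blast
    moreover from eng_mult.IH(2) obtain c d
      where "c \<in> ?S" "d \<in> ?S" "d \<noteq> 0" "h2 = to_fract c / to_fract d"
      by blast
    ultimately show ?case
      by (intro bexI[of _ "a * c"] bexI[of _ "b * d"])
        (simp_all add: value_subring_closed)
  qed
  with that show thesis by blast
qed

text \<open>
  Multiplication by such a \<open>b\<close> turns a linear relation over \<open>\<real>(p, q)\<close> into one over \<open>\<real>[p, q]\<close>.
\<close>

lemma ratfun_subfield_common_denominator:
  assumes "\<And>i. i < n \<Longrightarrow> k i \<in> ratfun_subfield p q"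
  shows "\<exists>b\<in>value_subring p q. b \<noteq> 0 \<and>
    (\<forall>i<n::nat. k i * to_fract b \<in> to_fract ` value_subring p q)"
  using assms
proof (induction n)
  case 0
  show ?case
    by (rule bexI[of _ 1]) (simp_all add: value_subring_closed)
next
  case (Suc n)
  have "\<exists>b\<in>value_subring p q. b \<noteq> 0 \<and>
      (\<forall>i<n. k i * to_fract b \<in> to_fract ` value_subring p q)"
    by (rule Suc.IH) (simp add: Suc.prems)
  then obtain b where b: "b \<in> value_subring p q" "b \<noteq> 0"
    and IH: "\<And>i. i < n \<Longrightarrow> k i * to_fract b \<in> to_fract ` value_subring p q"
    by blast
  have "k n \<in> ratfun_subfield p q"
    by (simp add: Suc.prems)
  then obtain c d where c: "c \<in> value_subring p q" "d \<in> value_subring p q" "d \<noteq> 0"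
    "k n = to_fract c / to_fract d"
    by (rule ratfun_subfield_fraction)
  have "k i * to_fract (b * d) \<in> to_fract ` value_subring p q" if "i < Suc n" for i
  proof (cases "i = n")
    case True
    then have "k i * to_fract (b * d) = to_fract (c * b)"
      using c by simp
    then show ?thesis
      using b c value_subring_closed(7) by blast
  next
    case False
    then obtain a where "a \<in> value_subring p q" "k i * to_fract b = to_fract a"
      using IH[of i] \<open>i < Suc n\<close> by auto
    then have "k i * to_fract (b * d) = to_fract (a * d)" "a * d \<in> value_subring p q"
      using c(2) by (simp_all add: value_subring_closed flip: mult.assoc)
    then show ?thesis
      by blast
  qed
  then show ?case
    using b c by (intro bexI[of _ "b * d"]) (simp_all add: value_subring_closed)
qed

section \<open>The degree of a simple extension\<close>

text \<open>
  The minimal polynomial of \<open>x\<close> divides \<open>p\<close>, so its degree is at most \<open>n\<close>; if its degree were smaller,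
  its coefficients would be a relation excluded by the last hypothesis.  Irreducibility of \<open>p\<close> is thereby
  replaced by a statement on linear independence.
\<close>

lemma (in domain) dimension_simple_extension_eqI:
  assumes K: "subfield K R" and x: "x \<in> carrier R"
    and p: "p \<in> carrier (K[X])" "p \<noteq> []" "eval p x = \<zero>" "length p = Suc n"
    and indep: "\<And>Ks. \<lbrakk> set Ks \<subseteq> K; length Ks \<le> n; eval Ks x = \<zero> \<rbrakk> \<Longrightarrow> set Ks \<subseteq> {\<zero>}"
  shows "(algebraic over K) x" "dimension n K (simple_extension K x)"
proof -
  show alg: "(algebraic over K) x"
    using p by (intro algebraicI)
  let ?m = "Irr K x"
  note Irr = IrrE[OF K x alg]
  have m: "set ?m \<subseteq> K" "?m \<noteq> []"
    using Irr(1,2) unfolding univ_poly_carrier[symmetric] polynomial_def ring_irreducible_def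
    by (auto simp: univ_poly_zero)
  have "length ?m - 1 \<le> n"
    using pdivides_imp_degree_le[OF subfieldE(1)[OF K] Irr(1) p(1,2) Irr_minimal[OF K x alg p(1,3)]]
      p(4) by simp
  moreover have "\<not> length ?m \<le> n"
  proof
    assume "length ?m \<le> n"
    then have "set ?m \<subseteq> {\<zero>}"
      using indep m Irr(4) by blast
    moreover have "hd ?m \<in> set ?m"
      using m(2) by simp
    ultimately show False
      using Irr(3) one_not_zero by auto
  qed
  ultimately have "length ?m - 1 = n"
    by simp
  then show "dimension n K (simple_extension K x)"
    using dimension_simple_extension[OF K x alg] by simp
qed

lemma ratfun_eval:
  "ring.eval ratfun_field Ks x = (\<Sum>i<length Ks. Ks ! (length Ks - Suc i) * x ^ i)"
proof (induction Ks)
  case Nil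
  show ?case
    by (simp add: ring.eval.simps[OF ring_ratfun_field])
next
  case (Cons k Ks)
  have "(k # Ks) ! (length Ks - i) = Ks ! (length Ks - Suc i)" if "i < length Ks" for i
    using that by (simp add: nth_Cons')
  then show ?case
    by (simp add: ring.eval.simps[OF ring_ratfun_field] Cons)
qed

section \<open>Substituting a reduced fraction\<close>

text \<open>
  The linear factor is prime, being the kernel of evaluation at \<open>a\<close>.  Arguing with this root instead of
  greatest common divisors lets the coefficients range over any integral domain; below it is \<open>\<real>[P]\<close>.
\<close>

lemma dvd_mult_linear_power_cancel:
  fixes M :: "'a::idom poly"
  assumes "poly M a \<noteq> 0" "M dvd b * [:- a, 1:] ^ n"
  shows "M dvd b"
  using assms(2)
proof (induction n)
  case (Suc n)
  then obtain c where c: "b * [:- a, 1:] ^ n * [:- a, 1:] = M * c"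
    by (auto simp: dvd_def mult_ac)
  then have "poly M a * poly c a = 0"
    using arg_cong[OF c, of "\<lambda>r. poly r a"] unfolding poly_mult by simp
  then obtain d where "c = [:- a, 1:] * d"
    using assms(1) by (auto simp: poly_eq_0_iff_dvd dvd_def)
  with c have "[:- a, 1:] * (b * [:- a, 1:] ^ n) = [:- a, 1:] * (M * d)"
    by (simp only: mult_ac)
  then have "b * [:- a, 1:] ^ n = M * d"
    by (subst (asm) mult_left_cancel) simp_all
  then show ?case
    using Suc.IH by simp
qed simp

text \<open>
  The sum is \<open>E\<^sup>m\<close> times the value of \<open>\<Sum>\<^sub>j g\<^sub>j v\<^sup>j\<close> at the reduced fraction \<open>v = M / E\<close>.  Modulo \<open>M\<close>
  only the term \<open>g\<^sub>0 E\<^sup>m\<close> survives, so \<open>M\<close> divides \<open>g\<^sub>0\<close>, which is too small in degree unless it is zero;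
  cancelling one factor \<open>M\<close> leaves a sum of the same form.
\<close>

lemma homogenized_sum_eq_0_imp_coeffs_eq_0:
  fixes M E :: "'a::idom poly"
  assumes coprime: "\<And>b n. M dvd b * E ^ n \<Longrightarrow> M dvd b"
    and "\<And>j. Polynomial.degree (g j) < Polynomial.degree M"
    and "(\<Sum>j\<le>m. g j * M ^ j * E ^ (m - j)) = 0" and "j \<le> m"
  shows "g j = 0"
  using assms(2-4)
proof (induction m arbitrary: g j)
  case 0
  then show ?case by simp
next
  case (Suc m)
  let ?S = "\<Sum>j\<le>m. g (Suc j) * M ^ j * E ^ (m - j)"
  have M: "M \<noteq> 0"
    using Suc.prems(1)[of 0] by auto
  have sum: "g 0 * E ^ Suc m + M * ?S = 0"
    using Suc.prems(2)
    by (subst (asm) sum.atMost_Suc_shift) (simp add: sum_distrib_left mult.commute mult.left_commute)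
  then have "g 0 * E ^ Suc m = M * (- ?S)"
    by (simp add: eq_neg_iff_add_eq_0)
  then have "M dvd g 0 * E ^ Suc m"
    by (rule dvdI)
  then have "M dvd g 0"
    by (rule coprime)
  then have g0: "g 0 = 0"
    using Suc.prems(1)[of 0] dvd_imp_degree_le[of M "g 0"] by (meson not_le)
  have "?S = 0"
    using sum M unfolding g0 by simp
  then have IH: "g (Suc i) = 0" if "i \<le> m" for i
    by (rule Suc.IH[OF Suc.prems(1) _ that])
  show ?case
    using g0 IH Suc.prems(3) by (cases j) simp_all
qed

section \<open>The relations between the components of the Pinchuk map\<close>

text \<open>
  The difference of the two sides is \<open>t\<^sup>2 a\<^sup>2 (t + 1 - x y)\<close>.
\<close>

lemma t_f_identity:
  fixes t a x y :: "'a::idom"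
  assumes "x * y = t + 1" "a = x * t + 1"
  shows "t * (a\<^sup>2 * (t\<^sup>2 + y)) = (t * a) * (a\<^sup>2 * (t\<^sup>2 + y)) - (t * a)\<^sup>2 * (t * a + 1)"
  using assms by Groebner_Basis.algebra

lemma pinchuk_t_f: "pinchuk_t * pinchuk_f = pinchuk_h * pinchuk_f - pinchuk_h\<^sup>2 * (pinchuk_h + 1)"
  unfolding pinchuk_f_def pinchuk_h_def
  by (rule t_f_identity[where x = var_x]) (simp_all add: pinchuk_t_def)

text \<open>
  The left-hand side is \<open>4 N(P, h)\<close>.  The factor 4 clears the denominators, which all come from \<open>c = 75/4\<close>;
  with \<open>c\<close> as a variable the identity can be used both for real values and in the field of rational
  functions.
\<close>

lemma sextic_identity:
  fixes f h t c P Q :: "'a::idom"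
  assumes tf: "t * f = h * f - h\<^sup>2 * (h + 1)" and c: "4 * c = 75"
    and P: "P = f + h"
    and Q: "Q = - t\<^sup>2 - 6 * t * h * (h + 1)
      - (170 * f * h + 91 * h^2 + 195 * f * h^2 + 69 * h^3 + 75 * f * h^3 + c * h^4)"
  shows "197 * h ^ 6 + (416 - 726 * P) * h ^ 5 + (252 - 1684 * P + 825 * P\<^sup>2) * h ^ 4
    + (2040 * P\<^sup>2 - 1224 * P - 300 * P ^ 3) * h ^ 3
    + (1648 * P\<^sup>2 - 780 * P ^ 3) * h\<^sup>2 - 680 * P ^ 3 * h = 4 * (h - P)\<^sup>2 * Q"
proof -
  \<comment> \<open>Since \<open>h - P = - f\<close>, the variable \<open>t\<close> can be made to occur only in products \<open>t * f\<close>.\<close>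
  have "4 * (h - P)\<^sup>2 * Q = - 4 * (t * f)\<^sup>2 - 24 * (t * f) * f * h * (h + 1)
    - f\<^sup>2 * (680 * f * h + 364 * h^2 + 780 * f * h^2 + 276 * h^3 + 300 * f * h^3 + (4 * c) * h^4)"
    unfolding P Q by Groebner_Basis.algebra
  then show ?thesis
    unfolding tf c P by Groebner_Basis.algebra
qed

text \<open>
  In \<open>pinchuk_N\<close> and \<open>pinchuk_D\<close> the inner variable stands for \<open>P\<close> and the outer one for \<open>h\<close>.
\<close>

definition pinchuk_N :: real_poly2 where
  "pinchuk_N =
     [:0, [:0, 0, 0, -170:], [:0, 0, 412, -195:], [:0, -306, 510, -75:],
       [:63, -421, 825/4:], [:104, -363/2:], [:197/4:]:]"

definition pinchuk_D :: real_poly2 where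
  "pinchuk_D = [:- [:0, 1:], 1:] ^ 2"

lemma eval2_pinchuk_D [simp]: "eval2 pinchuk_D p h = (h - p)\<^sup>2"
  by (simp add: eval2_def pinchuk_D_def)

lemma degree_pinchuk_N: "Polynomial.degree pinchuk_N = 6"
  by (simp add: pinchuk_N_def)

lemma pinchuk_N_coprime_D:
  assumes "pinchuk_N dvd b * pinchuk_D ^ n"
  shows "pinchuk_N dvd b"
proof (rule dvd_mult_linear_power_cancel)
  show "pinchuk_N dvd b * [:- [:0, 1:], 1:] ^ (2 * n)"
    using assms by (simp add: pinchuk_D_def power_mult)
  \<comment> \<open>The value of \<open>N(P, P) = - P\<^sup>4 (P + 1)\<^sup>2\<close> at \<open>P = 1\<close> is \<open>- 4\<close>.\<close>
  have "poly (poly pinchuk_N [:0, 1:]) 1 \<noteq> 0"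
    by (simp add: pinchuk_N_def)
  then show "poly pinchuk_N [:0, 1:] \<noteq> 0"
    by auto
qed

lemma pinchuk_Q_eq_N_over_D:
  "eval2 pinchuk_D (eval2 pinchuk_P x y) (eval2 pinchuk_h x y) * eval2 pinchuk_Q x y
     = eval2 pinchuk_N (eval2 pinchuk_P x y) (eval2 pinchuk_h x y)"
proof -
  let ?e = "\<lambda>G. eval2 G x y"
  let ?P = "?e pinchuk_P" and ?Q = "?e pinchuk_Q" and ?h = "?e pinchuk_h"
  have tf: "?e pinchuk_t * ?e pinchuk_f = ?h * ?e pinchuk_f - ?h\<^sup>2 * (?h + 1)"
    using arg_cong[OF pinchuk_t_f, of ?e] by simp
  have "4 * eval2 pinchuk_N ?P ?h = 197 * ?h ^ 6 + (416 - 726 * ?P) * ?h ^ 5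
      + (252 - 1684 * ?P + 825 * ?P\<^sup>2) * ?h ^ 4
      + (2040 * ?P\<^sup>2 - 1224 * ?P - 300 * ?P ^ 3) * ?h ^ 3
      + (1648 * ?P\<^sup>2 - 780 * ?P ^ 3) * ?h\<^sup>2 - 680 * ?P ^ 3 * ?h"
    by (simp add: pinchuk_N_def eval2_def[of "pCons _ _"] algebra_simps eval_nat_numeral)
  also have "\<dots> = 4 * (?h - ?P)\<^sup>2 * ?Q"
    by (rule sextic_identity[OF tf, of "75/4"])
      (simp_all add: pinchuk_P_def pinchuk_Q_def pinchuk_u_def)
  finally show ?thesis
    by simp
qed

text \<open>
  The preimage is found by solving \<open>t f = h f - h\<^sup>2 (h + 1)\<close> for \<open>t\<close>, then \<open>h = t (x t + 1)\<close> for \<open>x\<close>,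
  then \<open>t = x y - 1\<close> for \<open>y\<close>.  The hypotheses say that \<open>f\<close>, \<open>t\<close> and \<open>h - t\<close> do not vanish.
\<close>

lemma pinchuk_P_h_dominant:
  fixes p h :: real
  assumes "h \<noteq> 0" "h \<noteq> -1" "p \<noteq> h" "p \<noteq> h + h * (h + 1)"
  obtains x y where "eval2 pinchuk_P x y = p" "eval2 pinchuk_h x y = h"
proof -
  define f where "f = p - h"
  define t where "t = h - h\<^sup>2 * (h + 1) / f"
  define x where "x = (h / t - 1) / t"
  define y where "y = (t + 1) / x"
  have f: "f \<noteq> 0"
    using assms by (simp add: f_def)
  have tf: "t * f = h * (f - h * (h + 1))"
    using f by (simp add: t_def field_simps power2_eq_square)
  with f assms have t: "t \<noteq> 0"
    by (auto simp: f_def)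
  have ht: "h \<noteq> t"
    using f assms by (simp add: t_def)
  have x: "x \<noteq> 0"
    using t ht by (simp add: x_def)
  have et: "eval2 pinchuk_t x y = t"
    using x by (simp add: pinchuk_t_def y_def)
  have A: "x * t + 1 = h / t"
    using t by (simp add: x_def)
  have eh: "eval2 pinchuk_h x y = h"
    using t by (simp add: pinchuk_h_def et A)
  have "(h - t) * eval2 pinchuk_f x y = h\<^sup>2 * (h + 1)"
    using arg_cong[OF pinchuk_t_f, of "\<lambda>G. eval2 G x y"] by (simp add: et eh algebra_simps)
  also have "\<dots> = (h - t) * f"
    using tf by (simp add: algebra_simps power2_eq_square)
  finally have "eval2 pinchuk_f x y = f"
    using ht by simp
  with eh show thesis
    by (intro that[of x y]) (simp_all add: pinchuk_P_def f_def)
qed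

section \<open>The element \<open>h\<close> has degree 6 over \<open>\<real>(P, Q)\<close>\<close>

text \<open>
  With \<open>a i = G i (P, Q)\<close> and \<open>Q = N / D\<close>, sorting \<open>\<Sum>\<^sub>i a\<^sub>i h\<^sup>i\<close> by powers of \<open>Q\<close> instead of powers of
  \<open>h\<close> gives \<open>\<Sum>\<^sub>j g\<^sub>j (N / D)\<^sup>j\<close>, where \<open>g\<^sub>j\<close> is assembled from the coefficients at \<open>Q\<^sup>j\<close> of all
  \<open>G i\<close> and has degree at most 5 in \<open>h\<close>.
\<close>

lemma pinchuk_h_powers_independent:
  assumes a: "\<And>i. i < 6 \<Longrightarrow> a i \<in> value_subring pinchuk_P pinchuk_Q"
    and sum: "(\<Sum>i<6. a i * pinchuk_h ^ i) = 0" and "i < 6"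
  shows "a i = 0"
proof -
  obtain G where G: "\<And>i x y. i < 6 \<Longrightarrow>
      eval2 (a i) x y = eval2 (G i) (eval2 pinchuk_P x y) (eval2 pinchuk_Q x y)"
    using a unfolding value_subring_def mem_Collect_eq by metis
  define m where "m = (\<Sum>i<6. Polynomial.degree (G i))"
  have deg_G: "Polynomial.degree (G i) \<le> m" if "i < 6" for i
    unfolding m_def using that by (intro member_le_sum) auto
  define g where "g j = (\<Sum>i<6. Polynomial.monom (Polynomial.coeff (G i) j) i)" for j
  have eval_g: "eval2 (g j) p h = (\<Sum>i<6. poly (Polynomial.coeff (G i) j) p * h ^ i)" for j p h
    by (simp add: g_def) (simp add: eval2_def poly_monom)
  have T: "(\<Sum>j\<le>m. g j * pinchuk_N ^ j * pinchuk_D ^ (m - j)) = 0" (is "?T = 0")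
  proof (rule eval2_generically_0_imp_0)
    fix p h :: real
    assume "h \<notin> {0, -1}" "p \<notin> {h, h + h * (h + 1)}"
    then obtain x y where xy: "eval2 pinchuk_P x y = p" "eval2 pinchuk_h x y = h"
      using pinchuk_P_h_dominant[of h p] by auto
    define q where "q = eval2 pinchuk_Q x y"
    let ?N = "eval2 pinchuk_N p h" and ?D = "eval2 pinchuk_D p h"
    have N: "?N = ?D * q"
      using pinchuk_Q_eq_N_over_D[of x y] by (simp add: xy q_def)
    have swap: "(\<Sum>j\<le>m. eval2 (g j) p h * q ^ j) = (\<Sum>i<6. eval2 (G i) p q * h ^ i)"
      unfolding eval_g sum_distrib_right
      by (subst sum.swap)
        (simp add: eval2_eq_sum_coeff[OF deg_G] sum_distrib_left sum_distrib_right mult_ac)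
    have "eval2 ?T p h = (\<Sum>j\<le>m. ?D ^ m * (eval2 (g j) p h * q ^ j))"
      by (simp add: N power_mult_distrib mult_ac flip: power_add)
    also have "\<dots> = ?D ^ m * (\<Sum>i<6. eval2 (G i) p q * h ^ i)"
      by (simp only: swap flip: sum_distrib_left)
    also have "(\<Sum>i<6. eval2 (G i) p q * h ^ i) = eval2 (\<Sum>i<6. a i * pinchuk_h ^ i) x y"
      by (simp add: G xy q_def)
    also have "\<dots> = 0"
      by (simp add: sum)
    finally show "eval2 ?T p h = 0"
      by simp
  qed auto
  have deg_g: "Polynomial.degree (g j) < Polynomial.degree pinchuk_N" for j
  proof -
    have "Polynomial.degree (g j) \<le> 5"
      unfolding g_def by (intro degree_sum_le) (auto intro: degree_monom_le[THEN order_trans])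
    then show ?thesis
      by (simp add: degree_pinchuk_N)
  qed
  have g: "g j = 0" if "j \<le> m" for j
    by (rule homogenized_sum_eq_0_imp_coeffs_eq_0[where E = pinchuk_D, OF pinchuk_N_coprime_D deg_g T that])
  have "Polynomial.coeff (G i) j = Polynomial.coeff (g j) i" for j
    using \<open>i < 6\<close> by (simp add: g_def coeff_sum)
  then have "Polynomial.coeff (G i) j = 0" for j
    using g[of j] deg_G[OF \<open>i < 6\<close>] coeff_eq_0[of "G i" j] by (cases "j \<le> m") auto
  then have "G i = 0"
    by (simp add: poly_eq_iff)
  then show ?thesis
    using G[OF \<open>i < 6\<close>] by (intro eval2_generically_0_imp_0[of "{}" "\<lambda>_. {}"]) auto
qed

lemma to_fract_numeral [simp]: "to_fract (numeral k) = numeral k"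
proof -
  have "to_fract (of_nat n) = of_nat n" for n
    by (induction n) simp_all
  from this[of "numeral k"] show ?thesis
    by simp
qed

lemma to_fract_power [simp]: "to_fract (a ^ n) = to_fract a ^ n"
  by (induction n) simp_all

lemma pinchuk_h_sextic:
  defines "P \<equiv> to_fract pinchuk_P" and "Q \<equiv> to_fract pinchuk_Q" and "h \<equiv> to_fract pinchuk_h"
  shows "197 * h ^ 6 + (416 - 726 * P) * h ^ 5 + (252 - 1684 * P + 825 * P\<^sup>2) * h ^ 4
    + (2040 * P\<^sup>2 - 1224 * P - 300 * P ^ 3) * h ^ 3
    + (1648 * P\<^sup>2 - 780 * P ^ 3 - 4 * Q) * h\<^sup>2 + (8 * P * Q - 680 * P ^ 3) * h - 4 * P\<^sup>2 * Q = 0"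
proof -
  let ?t = "to_fract pinchuk_t" and ?f = "to_fract pinchuk_f" and ?c = "to_fract (const2 (75/4))"
  have tf: "?t * ?f = h * ?f - h\<^sup>2 * (h + 1)"
    using arg_cong[OF pinchuk_t_f, of to_fract] by (simp add: h_def)
  have "to_fract (4 * const2 (75/4)) = to_fract 75"
    by (simp only: const2_def numeral_poly) simp
  then have c: "4 * ?c = 75"
    by simp
  have "197 * h ^ 6 + (416 - 726 * P) * h ^ 5 + (252 - 1684 * P + 825 * P\<^sup>2) * h ^ 4
    + (2040 * P\<^sup>2 - 1224 * P - 300 * P ^ 3) * h ^ 3
    + (1648 * P\<^sup>2 - 780 * P ^ 3) * h\<^sup>2 - 680 * P ^ 3 * h = 4 * (h - P)\<^sup>2 * Q"
    by (rule sextic_identity[OF tf c])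
      (simp_all add: P_def Q_def h_def pinchuk_P_def pinchuk_Q_def pinchuk_u_def)
  then show ?thesis
    by Groebner_Basis.algebra
qed

text \<open>
  After clearing denominators this is the independence of the powers of \<open>h\<close>.  Coefficient lists start
  with the leading coefficient, hence the reversed indexing.
\<close>

lemma pinchuk_h_no_relation_below_6:
  fixes Ks :: "real_poly2 fract list"
  defines "h \<equiv> to_fract pinchuk_h"
  assumes Ks: "set Ks \<subseteq> ratfun_subfield pinchuk_P pinchuk_Q" "length Ks \<le> 6"
    and eval: "ring.eval ratfun_field Ks h = 0"
  shows "set Ks \<subseteq> {0}"
proof -
  let ?n = "length Ks" and ?V = "value_subring pinchuk_P pinchuk_Q"
  define k where "k i = (if i < ?n then Ks ! (?n - Suc i) else 0)" for i
  have kK: "k i \<in> ratfun_subfield pinchuk_P pinchuk_Q" for i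
  proof (cases "i < ?n")
    case True
    then have "k i \<in> set Ks"
      by (simp add: k_def)
    with Ks(1) show ?thesis ..
  next
    case False
    then show ?thesis
      using subfield_ratfun_closed(1)[OF subfield_ratfun_subfield] by (simp add: k_def)
  qed
  have "(\<Sum>i<6. k i * h ^ i) = (\<Sum>i<?n. k i * h ^ i)"
    using Ks(2) by (intro sum.mono_neutral_right) (auto simp: k_def)
  also have "\<dots> = 0"
    using eval by (simp add: ratfun_eval k_def)
  finally have sum_k: "(\<Sum>i<6. k i * h ^ i) = 0" .
  obtain b where "b \<noteq> 0" and b: "\<And>i. i < 6 \<Longrightarrow> k i * to_fract b \<in> to_fract ` ?V"
    using ratfun_subfield_common_denominator[of 6 k, OF kK] by blast
  have "\<exists>a. a \<in> ?V \<and> to_fract a = k i * to_fract b" if "i < 6" for i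
    using b[OF that] by auto
  then obtain a where a: "\<And>i. i < 6 \<Longrightarrow> a i \<in> ?V" "\<And>i. i < 6 \<Longrightarrow> to_fract (a i) = k i * to_fract b"
    by metis
  have "to_fract (\<Sum>i<6. a i * pinchuk_h ^ i) = (\<Sum>i<6. (k i * h ^ i) * to_fract b)"
    by (simp add: a(2) h_def mult.commute mult.left_commute)
  also have "\<dots> = 0"
    by (simp add: sum_k flip: sum_distrib_right)
  finally have "(\<Sum>i<6. a i * pinchuk_h ^ i) = 0"
    by (simp only: to_fract_eq_0_iff)
  then have "a i = 0" if "i < 6" for i
    using pinchuk_h_powers_independent[of a, OF a(1)] that by blast
  then have k0: "k i = 0" if "i < 6" for i
    using a(2)[OF that] that \<open>b \<noteq> 0\<close> by simp
  have "Ks ! i = 0" if "i < ?n" for i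
  proof -
    have "k (?n - Suc i) = Ks ! i"
      using that by (simp add: k_def Suc_diff_Suc)
    moreover have "k (?n - Suc i) = 0"
      using that Ks(2) by (intro k0) linarith
    ultimately show ?thesis
      by simp
  qed
  then show ?thesis
    by (auto simp: in_set_conv_nth)
qed

section \<open>Recovering the coordinates from \<open>P\<close> and \<open>h\<close>\<close>

lemma ratfun_subfield_generated_by_coordinates:
  assumes E: "subfield E ratfun_field"
    and "\<And>c. to_fract (const2 c) \<in> E" "to_fract var_x \<in> E" "to_fract var_y \<in> E"
  shows "E = UNIV"
proof -
  note closed = subfield_ratfun_closed[OF E]
  have const: "to_fract [:a:] \<in> E" for a :: "real poly"
  proof (induction a)
    case (pCons c a)
    have "to_fract [:pCons c a:] = to_fract (const2 c) + to_fract var_x * to_fract [:a:]"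
      by (simp add: const2_def var_x_def flip: to_fract_add to_fract_mult)
    then show ?case
      using assms pCons by (simp add: closed)
  qed (use closed in simp)
  have poly: "to_fract G \<in> E" for G :: real_poly2
  proof (induction G)
    case (pCons a G)
    have "to_fract (pCons a G) = to_fract [:a:] + to_fract var_y * to_fract G"
      by (simp add: var_y_def flip: to_fract_add to_fract_mult)
    then show ?case
      using assms pCons const by (simp add: closed)
  qed (use closed in simp)
  have "z \<in> E" for z
  proof (cases z)
    case (Fract a b)
    then show ?thesis
      using poly closed(7) by (simp add: Fract_conv_to_fract)
  qed
  then show ?thesis by blast
qed

lemma pinchuk_P_h_generate:
  assumes E: "subfield E ratfun_field" and const: "\<And>c. to_fract (const2 c) \<in> E"
    and P: "to_fract pinchuk_P \<in> E" and h: "to_fract pinchuk_h \<in> E"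
  shows "E = UNIV"
proof -
  note E_closed = subfield_ratfun_closed[OF E]
  define f t x y h' where defs: "f = to_fract pinchuk_f" "t = to_fract pinchuk_t"
    "x = to_fract var_x" "y = to_fract var_y" "h' = to_fract pinchuk_h"
  have "eval2 pinchuk_t 0 0 \<noteq> 0" "eval2 pinchuk_f 0 1 \<noteq> 0" "eval2 var_x 1 0 \<noteq> 0"
    by (simp_all add: pinchuk_t_def pinchuk_f_def)
  then have "pinchuk_t \<noteq> 0" "pinchuk_f \<noteq> 0" "var_x \<noteq> 0"
    by (metis eval2_ring_simps(1))+
  then have nz: "t \<noteq> 0" "f \<noteq> 0" "x \<noteq> 0"
    by (simp_all add: defs)
  have h': "h' \<in> E"
    using h by (simp add: defs)
  have "f = to_fract pinchuk_P - to_fract pinchuk_h"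
    by (simp add: defs pinchuk_P_def)
  then have f: "f \<in> E"
    using P h by (simp add: E_closed)
  have "t * f = h' * f - h'\<^sup>2 * (h' + 1)"
    using arg_cong[OF pinchuk_t_f, of to_fract] by (simp add: defs)
  then have "t = (h' * f - h'\<^sup>2 * (h' + 1)) / f"
    using nz(2) by (simp add: eq_divide_eq)
  then have t: "t \<in> E"
    using h' f by (simp add: E_closed)
  have "h' = t * (x * t + 1)"
    by (simp add: defs pinchuk_h_def)
  then have "x = (h' / t - 1) / t"
    using nz by simp
  then have x: "x \<in> E"
    using h' t by (simp add: E_closed)
  have "t = x * y - 1"
    by (simp add: defs pinchuk_t_def)
  then have "y = (t + 1) / x"
    using nz by simp
  then have y: "y \<in> E"
    using x t by (simp add: E_closed)
  show ?thesis
    by (rule ratfun_subfield_generated_by_coordinates[OF E const])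
      (use x y in \<open>simp_all add: defs\<close>)
qed

theorem corollary6:
  shows "ring.dimension ratfun_field 6 (ratfun_subfield pinchuk_P pinchuk_Q) (carrier ratfun_field)"
proof -
  interpret domain ratfun_field
    by (rule domain_ratfun_field)
  let ?K = "ratfun_subfield pinchuk_P pinchuk_Q"
  define P Q h where defs: "P = to_fract pinchuk_P" "Q = to_fract pinchuk_Q" "h = to_fract pinchuk_h"
  have K: "subfield ?K ratfun_field"
    by (rule subfield_ratfun_subfield)
  have PQ: "P \<in> ?K" "Q \<in> ?K"
    by (simp_all add: defs ratfun_subfield_generators)
  \<comment> \<open>The coefficients of \<open>4 (N(P, h) - Q (h - P)\<^sup>2)\<close>, from \<open>h\<^sup>6\<close> downwards.\<close>
  define s where "s = [197, 416 - 726 * P, 252 - 1684 * P + 825 * P\<^sup>2,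
    2040 * P\<^sup>2 - 1224 * P - 300 * P ^ 3, 1648 * P\<^sup>2 - 780 * P ^ 3 - 4 * Q,
    8 * P * Q - 680 * P ^ 3, - (4 * P\<^sup>2 * Q)]"
  have "set s \<subseteq> ?K"
    unfolding s_def by (simp add: subfield_ratfun_closed[OF K] PQ)
  then have s: "s \<in> carrier (univ_poly ratfun_field ?K)" "s \<noteq> []" "length s = Suc 6"
    by (simp_all add: s_def polynomial_def flip: univ_poly_carrier)
  have eval_s: "eval s h = \<zero>\<^bsub>ratfun_field\<^esub>"
    using pinchuk_h_sextic
    by (simp add: s_def defs ratfun_eval lessThan_Suc eval_nat_numeral algebra_simps)
  have h: "h \<in> carrier ratfun_field"
    by simp
  have indep: "set Ks \<subseteq> {\<zero>\<^bsub>ratfun_field\<^esub>}"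
    if "set Ks \<subseteq> ?K" "length Ks \<le> 6" "eval Ks h = \<zero>\<^bsub>ratfun_field\<^esub>" for Ks
    using pinchuk_h_no_relation_below_6[of Ks] that by (simp add: defs)
  note dim = dimension_simple_extension_eqI[OF K h s(1,2) eval_s s(3) indep]
  let ?E = "simple_extension ?K h"
  have "?K \<subseteq> ?E"
    by (rule simple_extension_incl) simp_all
  moreover have "h \<in> ?E"
    using simple_extension_mem[OF subfieldE(1)[OF K] h] .
  moreover have "subfield ?E ratfun_field"
    using simple_extension_is_subfield[OF K h] dim(1) by blast
  ultimately have "?E = UNIV"
    using PQ(1) ratfun_subfield_generators(1) unfolding defs
    by (intro pinchuk_P_h_generate) blast+
  with dim(2) show ?thesis
    by simp
qed

end
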